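(* Let $r\ge1$ and $\lambda>0$, and consider two finite scenario trees $\mathbb P$ and $\tilde{\mathbb P}$ with $T$ stages. Let $m$ (resp. $\tilde m$) be the maximum number of immediate successors of a node in $\mathbb P$ (resp. $\tilde{\mathbb P}$), i.e. $m=\max\{|i+|\colon i\in\mathcal N_t,\ t=0,\dots,T-1\}$ and analogously for $\tilde m$. Let $\boldsymbol d_W^r$ be the optimal value of the nested distance problem and $\boldsymbol{de}_S^r$ the optimal value of the entropy-regularized nested problem with parameter $\lambda$. Then $$\boldsymbol d_W^r-\boldsymbol{de}_S^r\le\frac{\log m+\log\tilde m}{\lambda}\cdot T .$$
   Context: Trees: A finite-valued process with its filtration is modelled by a finite rooted tree of height $T$. $\mathcal N_t$ (resp. $\tilde{\mathcal N}_t$) denotes the set of nodes at stage $t=0,\dots,T$ of the first (resp. second) tree; stage $0$ consists of the root only, and all leaves are at stage $T$. We write $m'\prec i$ (equivalently $i\succ m'$) if $m'$ is a (not necessarily immediate) predecessor of $i$, and $i+$ for the set of immediate successors of $i$. The first tree carries a probability measure $P$ on its leaves with weights $p_i$ and the second a probability measure $\tilde P$ with weights $\tilde p_j$, all weights positive; $P(i\mid i_t)=p_i/\sum_{i'\in\mathcal N_T,\,i'\succ i_t}p_{i'}$ for a leaf $i\succ i_t$, and similarly $\tilde P(j\mid j_t)$. For leaves $i\in\mathcal N_T$, $j\in\tilde{\mathcal N}_T$, $d_{ij}\ge 0$ is the distance between the trajectories ending in $i$ and $j$. Nested distance problem: minimize $\sum_{i,j}\pi_{ij}d_{ij}^r$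 over $\pi$ on $\mathcal N_T\times\tilde{\mathcal N}_T$ subject to, for all $t\in\{0,\dots,T-1\}$, $i_t\in\mathcal N_t$, $j_t\in\tilde{\mathcal N}_t$, $$\sum_{j\succ j_t}\pi(i,j\mid i_t,j_t)=P(i\mid i_t)\ \ (i\in\mathcal N_T,\ i\succ i_t),\qquad \sum_{i\succ i_t}\pi(i,j\mid i_t,j_t)=\tilde P(j\mid j_t)\ \ (j\in\tilde{\mathcal N}_T,\ j\succ j_t),$$ and $\pi_{ij}\ge 0$, $\sum_{i,j}\pi_{ij}=1$, where $\pi(i,j\mid i_t,j_t):=\pi_{ij}\big/\sum_{i'\succ i_t,\,j'\succ j_t}\pi_{i'j'}$ (sums over leaves). The constraints are understood as linear constraints in $\pi$, i.e. after multiplying by the denominator. Its optimal value is denoted $\boldsymbol d_W^r$. Entropy-regularized nested problem: minimize $\sum_{i,j}\bigl(\pi_{ij}d_{ij}^r+\frac1\lambda\pi_{ij}\log\pi_{ij}\bigr)$ subject to the same conditional constraints together with $\pi_{ij}>0$ and $\sum_{i,j}\pi_{ij}=1$. Its optimal value is denoted $\boldsymbol{de}_S^r$. No $r$-th root is taken in these symbols. *)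

theory Defs
  imports Complex_Main
begin

text \<open>A tree is given by its node sets per stage, the arcs from a node to its immediate
  successors, and the weights of its leaves. Node sets beyond the height and weights of
  inner nodes are never used.\<close>

record 'a prob_tree =
  height :: nat
  nodes :: "nat \<Rightarrow> 'a set"
  arcs :: "('a \<times> 'a) set"
  weight :: "'a \<Rightarrow> real"

abbreviation leaves :: "'a prob_tree \<Rightarrow> 'a set" where
  "leaves A \<equiv> nodes A (height A)"

text \<open>A node has exactly one immediate predecessor unless it is the root, and
  every node before the last stage has a successor, so that all leaves are at the last stage.\<close>

locale scenario_tree =
  fixes A :: "'a prob_tree"
  assumes finite_nodes: "t \<le> height A \<Longrightarrow> finite (nodes A t)"
    and disjoint_stages:
      "s \<le> height A \<Longrightarrow> t \<le> height A \<Longrightarrow> s \<noteq> t \<Longrightarrow> nodes A s \<inter> nodes A t = {}"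
    and root: "\<exists>v. nodes A 0 = {v}"
    and arcs_subset: "arcs A \<subseteq> (\<Union>t<height A. nodes A t \<times> nodes A (Suc t))"
    and unique_predecessor: "t < height A \<Longrightarrow> i \<in> nodes A (Suc t) \<Longrightarrow> \<exists>!v. (v, i) \<in> arcs A"
    and has_successor: "t < height A \<Longrightarrow> v \<in> nodes A t \<Longrightarrow> \<exists>i. (v, i) \<in> arcs A"
    and weight_pos: "i \<in> leaves A \<Longrightarrow> 0 < weight A i"
    and weight_sum: "(\<Sum>i\<in>leaves A. weight A i) = 1"

definition immediate_successors :: "'a prob_tree \<Rightarrow> 'a \<Rightarrow> 'a set" where
  "immediate_successors A v = {i. (v, i) \<in> arcs A}"

definition predecessor :: "'a prob_tree \<Rightarrow> 'a \<Rightarrow> 'a \<Rightarrow> bool" where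
  "predecessor A v i \<longleftrightarrow> (v, i) \<in> (arcs A)\<^sup>+"

definition leaves_after :: "'a prob_tree \<Rightarrow> 'a \<Rightarrow> 'a set" where
  "leaves_after A v = {i \<in> leaves A. predecessor A v i}"

text \<open>For height 0 this is a maximum over the empty set, hence unspecified.\<close>

definition max_branching :: "'a prob_tree \<Rightarrow> nat" where
  "max_branching A =
     Max {card (immediate_successors A v) | v t. t < height A \<and> v \<in> nodes A t}"

definition cond_prob :: "'a prob_tree \<Rightarrow> 'a \<Rightarrow> 'a \<Rightarrow> real" where
  "cond_prob A i v = weight A i / (\<Sum>i'\<in>leaves_after A v. weight A i')"

text \<open>The conditional marginal constraints of the nested distance, where
  \<open>\<pi>(i, j | v, w) = \<pi> i j / pair_mass A B \<pi> v w\<close>, are stated as linear constraints,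
  i.e. multiplied by the denominator. The two trees are meant to have equal height.\<close>

definition pair_mass ::
    "'a prob_tree \<Rightarrow> 'b prob_tree \<Rightarrow> ('a \<Rightarrow> 'b \<Rightarrow> real) \<Rightarrow> 'a \<Rightarrow> 'b \<Rightarrow> real" where
  "pair_mass A B \<pi> v w = (\<Sum>i\<in>leaves_after A v. \<Sum>j\<in>leaves_after B w. \<pi> i j)"

definition conditional_marginals ::
    "'a prob_tree \<Rightarrow> 'b prob_tree \<Rightarrow> ('a \<Rightarrow> 'b \<Rightarrow> real) \<Rightarrow> bool" where
  "conditional_marginals A B \<pi> \<longleftrightarrow>
     (\<forall>t<height A. \<forall>v\<in>nodes A t. \<forall>w\<in>nodes B t.
        (\<forall>i\<in>leaves_after A v.
           (\<Sum>j\<in>leaves_after B w. \<pi> i j) = cond_prob A i v * pair_mass A B \<pi> v w) \<and>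
        (\<forall>j\<in>leaves_after B w.
           (\<Sum>i\<in>leaves_after A v. \<pi> i j) = cond_prob B j w * pair_mass A B \<pi> v w))"

definition nested_feasible ::
    "'a prob_tree \<Rightarrow> 'b prob_tree \<Rightarrow> ('a \<Rightarrow> 'b \<Rightarrow> real) \<Rightarrow> bool" where
  "nested_feasible A B \<pi> \<longleftrightarrow>
     conditional_marginals A B \<pi> \<and>
     (\<forall>i\<in>leaves A. \<forall>j\<in>leaves B. 0 \<le> \<pi> i j) \<and>
     (\<Sum>i\<in>leaves A. \<Sum>j\<in>leaves B. \<pi> i j) = 1"

definition entropic_feasible ::
    "'a prob_tree \<Rightarrow> 'b prob_tree \<Rightarrow> ('a \<Rightarrow> 'b \<Rightarrow> real) \<Rightarrow> bool" where
  "entropic_feasible A B \<pi> \<longleftrightarrow>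
     conditional_marginals A B \<pi> \<and>
     (\<forall>i\<in>leaves A. \<forall>j\<in>leaves B. 0 < \<pi> i j) \<and>
     (\<Sum>i\<in>leaves A. \<Sum>j\<in>leaves B. \<pi> i j) = 1"

text \<open>Optimal values. For scenario trees of equal height both infima are over nonempty sets
  (the product of the weights is feasible) that are bounded below. No \<open>r\<close>-th root is taken.\<close>

definition nested_distance_value ::
    "'a prob_tree \<Rightarrow> 'b prob_tree \<Rightarrow> ('a \<Rightarrow> 'b \<Rightarrow> real) \<Rightarrow> real \<Rightarrow> real" where
  "nested_distance_value A B d r =
     Inf {\<Sum>i\<in>leaves A. \<Sum>j\<in>leaves B. \<pi> i j * d i j powr r | \<pi>. nested_feasible A B \<pi>}"

definition entropic_nested_value ::
    "'a prob_tree \<Rightarrow> 'b prob_tree \<Rightarrow> ('a \<Rightarrow> 'b \<Rightarrow> real) \<Rightarrow> real \<Rightarrow> real \<Rightarrow> real" where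
  "entropic_nested_value A B d r lam =
     Inf {\<Sum>i\<in>leaves A. \<Sum>j\<in>leaves B. \<pi> i j * d i j powr r + 1 / lam * (\<pi> i j * ln (\<pi> i j))
          | \<pi>. entropic_feasible A B \<pi>}"

end

(* Every plan that is feasible for the entropic problem is feasible for the nested distance
   problem, so the two objectives differ by at most the maximal entropy of a plan divided by
   lambda. That entropy is at most the logarithm of the number of pairs of leaves, and a tree
   of height T and branching at most m has at most m^T leaves. *)
theory Submission
  imports Defs
begin

text \<open>Gibbs' inequality against the uniform distribution: \<open>ln y \<le> y - 1\<close> is
  applied at \<open>y = 1 / (n * p x)\<close>, the ratio of the uniform weight to
  \<open>p x\<close>, and averaged with respect to \<open>p\<close>.\<close>

lemma entropy_le_ln_card:
  fixes p :: "'a \<Rightarrow> real"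
  assumes pos: "\<And>x. x \<in> S \<Longrightarrow> 0 < p x" and sum1: "(\<Sum>x\<in>S. p x) = 1"
  shows "- (\<Sum>x\<in>S. p x * ln (p x)) \<le> ln (real (card S))"
proof -
  \<comment> \<open>A sum over an infinite set is 0 by convention, so total mass 1 forces
    \<open>S\<close> to be finite.\<close>
  have "finite S" "S \<noteq> {}"
    using sum1 sum.infinite[of S p] by auto
  define n where "n = real (card S)"
  have n: "n > 0"
    using \<open>finite S\<close> \<open>S \<noteq> {}\<close> by (simp add: n_def card_gt_0_iff)
  \<comment> \<open>The correction \<open>1 / n - p x\<close> sums to 0 over \<open>S\<close>, since
    both weights have total mass 1; only \<open>ln n\<close> survives.\<close>
  have "- (p x * ln (p x)) \<le> p x * ln n + (1 / n - p x)" if "x \<in> S" for x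
  proof -
    have p: "0 < p x" using pos that .
    have "ln (1 / (n * p x)) \<le> 1 / (n * p x) - 1"
      using n p by (intro ln_le_minus_one) simp
    then have "p x * ln (1 / (n * p x)) \<le> p x * (1 / (n * p x) - 1)"
      using p by (intro mult_left_mono) auto
    moreover have "ln (1 / (n * p x)) = - ln n - ln (p x)"
      using n p by (simp add: ln_div ln_mult)
    ultimately show ?thesis
      using n p by (simp add: algebra_simps)
  qed
  then have "(\<Sum>x\<in>S. - (p x * ln (p x))) \<le> (\<Sum>x\<in>S. p x * ln n + (1 / n - p x))"
    by (rule sum_mono)
  also have "\<dots> = ln n"
    using n by (simp add: sum.distrib sum_subtractf sum1 flip: sum_distrib_right)
      (simp add: n_def)
  finally show ?thesis
    by (simp add: sum_negf n_def)
qed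

context scenario_tree
begin

text \<open>\<open>arcs_subset\<close> places the predecessor of a node only at some stage
  \<open>s\<close>; disjointness of the stages then forces \<open>s = t\<close>.\<close>

lemma nodes_Suc_subset:
  assumes t: "t < height A"
  shows "nodes A (Suc t) \<subseteq> (\<Union>v\<in>nodes A t. immediate_successors A v)"
proof
  fix i assume i: "i \<in> nodes A (Suc t)"
  then obtain v where v: "(v, i) \<in> arcs A"
    using unique_predecessor[OF t] by blast
  then obtain s where s: "s < height A" "v \<in> nodes A s" "i \<in> nodes A (Suc s)"
    using arcs_subset by blast
  have "s = t"
    using disjoint_stages[of "Suc s" "Suc t"] s i t by auto
  then show "i \<in> (\<Union>v\<in>nodes A t. immediate_successors A v)"
    using s v by (auto simp: immediate_successors_def)
qed

lemma card_immediate_successors_le: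
  assumes "t < height A" "v \<in> nodes A t"
  shows "card (immediate_successors A v) \<le> max_branching A"
proof -
  \<comment> \<open>Written as the image of a finite node set, the family is visibly finite, so its
    \<open>Max\<close> is an upper bound.\<close>
  have "{card (immediate_successors A v) | v t. t < height A \<and> v \<in> nodes A t}
      = (\<lambda>v. card (immediate_successors A v)) ` (\<Union>t<height A. nodes A t)"
    by auto
  moreover have "finite (\<Union>t<height A. nodes A t)"
    using finite_nodes by auto
  ultimately show ?thesis
    unfolding max_branching_def using assms by (intro Max_ge) auto
qed

lemma card_nodes_le: "t \<le> height A \<Longrightarrow> card (nodes A t) \<le> max_branching A ^ t"
proof (induction t)
  case 0
  then show ?case using root by auto
next
  case (Suc t)
  then have t: "t < height A" by simp
  then have fin: "finite (nodes A t)" by (simp add: finite_nodes)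
  \<comment> \<open>Cutting each successor set down to the stage turns the inclusion into an
    equality, so that the union bound speaks about \<open>nodes A (Suc t)\<close> itself.\<close>
  have "nodes A (Suc t) = (\<Union>v\<in>nodes A t. immediate_successors A v \<inter> nodes A (Suc t))"
    using nodes_Suc_subset[OF t] by blast
  then have "card (nodes A (Suc t))
      \<le> (\<Sum>v\<in>nodes A t. card (immediate_successors A v \<inter> nodes A (Suc t)))"
    using card_UN_le[OF fin] by metis
  also have "\<dots> \<le> (\<Sum>v\<in>nodes A t. max_branching A)"
  proof (rule sum_mono)
    fix v assume v: "v \<in> nodes A t"
    have "immediate_successors A v \<subseteq> (\<Union>s<height A. nodes A (Suc s))"
      using arcs_subset by (auto simp: immediate_successors_def)
    then have "finite (immediate_successors A v)"
      by (rule finite_subset) (auto simp: finite_nodes)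
    then have "card (immediate_successors A v \<inter> nodes A (Suc t)) \<le> card (immediate_successors A v)"
      by (intro card_mono) auto
    also have "\<dots> \<le> max_branching A"
      using card_immediate_successors_le t v .
    finally show "card (immediate_successors A v \<inter> nodes A (Suc t)) \<le> max_branching A" .
  qed
  also have "\<dots> \<le> max_branching A ^ Suc t"
    using Suc t by simp
  finally show ?case .
qed

lemma finite_leaves: "finite (leaves A)"
  by (simp add: finite_nodes)

lemma card_leaves_pos: "0 < card (leaves A)"
  using weight_sum finite_leaves by (auto simp: card_gt_0_iff)

lemma ln_card_leaves_le:
  "ln (real (card (leaves A))) \<le> real (height A) * ln (real (max_branching A))"
\<comment> \<open>At height 0 \<open>max_branching\<close> is unspecified, but its logarithm is
  multiplied by 0, and the single leaf gives \<open>ln 1 = 0\<close>.\<close>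
proof (cases "height A = 0")
  case True
  then show ?thesis using root by auto
next
  case False
  have le: "card (leaves A) \<le> max_branching A ^ height A"
    by (rule card_nodes_le) simp
  \<comment> \<open>Branching 0 with positive height would give the bound 0 on the number of leaves,
    yet there is at least one.\<close>
  then have pos: "0 < max_branching A"
    using card_leaves_pos False by (cases "max_branching A = 0") (auto simp: power_0_left)
  have "ln (real (card (leaves A))) \<le> ln (real (max_branching A) ^ height A)"
    using le card_leaves_pos by (intro ln_mono) (simp_all flip: of_nat_power)
  also have "\<dots> = real (height A) * ln (real (max_branching A))"
    using pos by (simp add: ln_realpow)
  finally show ?thesis .
qed

text \<open>This allows the denominator of \<open>cond_prob\<close> to be cancelled.\<close>

lemma leaves_after_mass_nonzero:
  assumes "i \<in> leaves_after A v"
  shows "(\<Sum>i'\<in>leaves_after A v. weight A i') \<noteq> 0"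
proof -
  have "finite (leaves_after A v)"
    using finite_leaves by (rule rev_finite_subset) (auto simp: leaves_after_def)
  then have "0 < (\<Sum>i'\<in>leaves_after A v. weight A i')"
    using assms weight_pos by (intro sum_pos) (auto simp: leaves_after_def)
  then show ?thesis by simp
qed

end

text \<open>The mass of a pair of subtrees under the independent coupling factorizes, so the
  conditional weights cancel against it. The coupling witnesses that the entropic infimum is over a
  nonempty set.\<close>

lemma product_entropic_feasible:
  assumes "scenario_tree A" "scenario_tree B"
  shows "entropic_feasible A B (\<lambda>i j. weight A i * weight B j)"
proof -
  interpret A: scenario_tree A by fact
  interpret B: scenario_tree B by fact
  have "pair_mass A B (\<lambda>i j. weight A i * weight B j) v w
      = (\<Sum>i\<in>leaves_after A v. weight A i) * (\<Sum>j\<in>leaves_after B w. weight B j)" for v w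
    by (simp add: pair_mass_def sum_product)
  then have "conditional_marginals A B (\<lambda>i j. weight A i * weight B j)"
    using A.leaves_after_mass_nonzero B.leaves_after_mass_nonzero
    by (auto simp: conditional_marginals_def cond_prob_def
        simp flip: sum_distrib_left sum_distrib_right)
  moreover have "(\<Sum>i\<in>leaves A. \<Sum>j\<in>leaves B. weight A i * weight B j) = 1"
    using A.weight_sum B.weight_sum by (simp flip: sum_product)
  ultimately show ?thesis
    using A.weight_pos B.weight_pos by (simp add: entropic_feasible_def)
qed

lemma entropic_feasible_imp_nested_feasible:
  "entropic_feasible A B \<pi> \<Longrightarrow> nested_feasible A B \<pi>"
  by (force simp: entropic_feasible_def nested_feasible_def intro: less_imp_le)

text \<open>An infimum of reals lies below its members only if the set is bounded below; here 0 is a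
  lower bound, as plans and powers are nonnegative.\<close>

lemma nested_distance_value_le:
  assumes "nested_feasible A B \<pi>"
  shows "nested_distance_value A B d r \<le> (\<Sum>i\<in>leaves A. \<Sum>j\<in>leaves B. \<pi> i j * d i j powr r)"
  unfolding nested_distance_value_def
proof (rule cInf_lower)
  show "bdd_below {\<Sum>i\<in>leaves A. \<Sum>j\<in>leaves B. \<pi> i j * d i j powr r | \<pi>. nested_feasible A B \<pi>}"
    by (rule bdd_belowI[of _ 0]) (auto simp: nested_feasible_def intro!: sum_nonneg)
qed (use assms in auto)

text \<open>A plan is a single distribution on pairs of leaves, and the logarithm of the number of
  pairs splits into one term per tree.\<close>

lemma entropic_feasible_entropy_le:
  assumes "scenario_tree A" "scenario_tree B" and \<pi>: "entropic_feasible A B \<pi>"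
  shows "- (\<Sum>i\<in>leaves A. \<Sum>j\<in>leaves B. \<pi> i j * ln (\<pi> i j))
    \<le> real (height A) * ln (real (max_branching A)) + real (height B) * ln (real (max_branching B))"
proof -
  interpret A: scenario_tree A by fact
  interpret B: scenario_tree B by fact
  have "- (\<Sum>(i, j)\<in>leaves A \<times> leaves B. \<pi> i j * ln (\<pi> i j))
      \<le> ln (real (card (leaves A \<times> leaves B)))"
    using entropy_le_ln_card[of "leaves A \<times> leaves B" "\<lambda>(i, j). \<pi> i j"] \<pi>
    by (auto simp: entropic_feasible_def sum.cartesian_product case_prod_beta)
  also have "\<dots> = ln (real (card (leaves A))) + ln (real (card (leaves B)))"
    using A.card_leaves_pos B.card_leaves_pos by (simp add: card_cartesian_product ln_mult)
  also have "\<dots> \<le> real (height A) * ln (real (max_branching A))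
      + real (height B) * ln (real (max_branching B))"
    using A.ln_card_leaves_le B.ln_card_leaves_le by (rule add_mono)
  finally show ?thesis by (simp add: sum.cartesian_product)
qed

theorem corollary4p4:
  fixes A :: "'a prob_tree" and B :: "'b prob_tree"
    and d :: "'a \<Rightarrow> 'b \<Rightarrow> real" and r lam :: real and T :: nat
  assumes "scenario_tree A" and "scenario_tree B"
    and "height A = T" and "height B = T"
    and "\<And>i j. i \<in> leaves A \<Longrightarrow> j \<in> leaves B \<Longrightarrow> 0 \<le> d i j"
    and "1 \<le> r" and "0 < lam"
  shows "nested_distance_value A B d r - entropic_nested_value A B d r lam
    \<le> (ln (real (max_branching A)) + ln (real (max_branching B))) / lam * real T"
proof -
  define C where "C = (ln (real (max_branching A)) + ln (real (max_branching B))) / lam * real T"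
  \<comment> \<open>In this rearranged form it suffices to bound the entropic cost of every feasible
    plan from below; no minimizer is required.\<close>
  have "nested_distance_value A B d r - C \<le> entropic_nested_value A B d r lam"
    unfolding entropic_nested_value_def
  proof (rule cInf_greatest)
    show "{\<Sum>i\<in>leaves A. \<Sum>j\<in>leaves B. \<pi> i j * d i j powr r + 1 / lam * (\<pi> i j * ln (\<pi> i j))
        | \<pi>. entropic_feasible A B \<pi>} \<noteq> {}"
      using product_entropic_feasible[OF assms(1,2)] by blast
  next
    fix x assume "x \<in> {\<Sum>i\<in>leaves A. \<Sum>j\<in>leaves B.
        \<pi> i j * d i j powr r + 1 / lam * (\<pi> i j * ln (\<pi> i j)) | \<pi>. entropic_feasible A B \<pi>}"
    then obtain \<pi> where \<pi>: "entropic_feasible A B \<pi>"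
      and x: "x = (\<Sum>i\<in>leaves A. \<Sum>j\<in>leaves B.
        \<pi> i j * d i j powr r + 1 / lam * (\<pi> i j * ln (\<pi> i j)))"
      by blast
    define H where "H = - (\<Sum>i\<in>leaves A. \<Sum>j\<in>leaves B. \<pi> i j * ln (\<pi> i j))"
    have "H / lam \<le> (T * ln (real (max_branching A)) + T * ln (real (max_branching B))) / lam"
      using entropic_feasible_entropy_le[OF assms(1,2) \<pi>] assms
      by (intro divide_right_mono) (auto simp: H_def)
    also have "\<dots> = C"
      by (simp add: C_def algebra_simps add_divide_distrib)
    finally have "H / lam \<le> C" .
    \<comment> \<open>The entropic objective is the transport cost of the same plan minus its
      entropy \<open>H\<close> over \<open>lam\<close>.\<close>
    moreover have "x = (\<Sum>i\<in>leaves A. \<Sum>j\<in>leaves B. \<pi> i j * d i j powr r) - H / lam"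
      by (simp add: x H_def sum.distrib sum_divide_distrib)
    moreover have "nested_distance_value A B d r
        \<le> (\<Sum>i\<in>leaves A. \<Sum>j\<in>leaves B. \<pi> i j * d i j powr r)"
      using nested_distance_value_le[OF entropic_feasible_imp_nested_feasible[OF \<pi>]] .
    ultimately show "nested_distance_value A B d r - C \<le> x"
      by simp
  qed
  then show ?thesis
    by (simp add: C_def)
qed

end
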